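(* Let $(X,f)$ be a dynamical system. (a) If $X$ has a dense orbit sequence, then $(X,f)$ is topologically transitive, i.e. for every pair $U,V$ of nonempty open subsets of $X$ the set $N(U,V)$ is nonempty. (b) If there exists $x\in X$ such that $\omega f(x)=X$, then for every pair $U,V$ of nonempty open subsets of $X$ the set $N_+(U,V)$ is infinite.
   Context: A dynamical system $(X,f)$ is a continuous map $f\colon X\to X$ on a nonempty topological space $X$ (no separation axiom is assumed). $\mathbb N$ is the set of nonnegative integers. For $A\subset X$, $k\in\mathbb Z$, $f^k(A)$ is the image of $A$ under $f^k$ if $k\ge 0$ and the preimage of $A$ under $f^{|k|}$ if $k<0$. An orbit sequence is either a bi-infinite sequence $\langle x_k:k\in\mathbb Z\rangle$ in $X$ with $f(x_k)=x_{k+1}$ for all $k$, or a sequence $\langle x_k:k\ge n\rangle$ (for some $n\in\mathbb Z$) with $f(x_k)=x_{k+1}$ for $k\ge n$ and $f^{-1}(\{x_n\})=\varnothing$. It is dense if its set of elements is dense in $X$. The omega-limit set is $\omega f(x)=\bigcap_{n\ge0}\overline{\{f^k(x):k\ge n\}}$. For $A,B\subset X$: $N(A,B)=\{k\in\mathbb Z: A\cap f^{-k}(B)\ne\varnothing\}$ and $N_+(A,B)=N(A,B)\cap\mathbb N$. *)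

theory Defs
  imports "HOL-Analysis.Abstract_Topology"
begin

definition dynamical_system :: "'a topology \<Rightarrow> ('a \<Rightarrow> 'a) \<Rightarrow> bool" where
  "dynamical_system X f \<longleftrightarrow> topspace X \<noteq> {} \<and> continuous_map X X f"

text \<open>
  The set $f^k(A)$ for an integer $k$. Preimages are taken inside the space, since \<open>f\<close> is
  unconstrained outside \<open>topspace X\<close>.
\<close>

definition set_iterate :: "'a topology \<Rightarrow> ('a \<Rightarrow> 'a) \<Rightarrow> int \<Rightarrow> 'a set \<Rightarrow> 'a set" where
  "set_iterate X f k A =
     (if k \<ge> 0 then (f ^^ nat k) ` A
      else {y \<in> topspace X. (f ^^ nat \<bar>k\<bar>) y \<in> A})"

text \<open>
  A sequence with index set \<open>I\<close> is encoded by a total function on the integers of which only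
  the values on \<open>I\<close> matter. A sequence that is not bi-infinite must start at a point without
  preimage.
\<close>

definition orbit_sequence ::
    "'a topology \<Rightarrow> ('a \<Rightarrow> 'a) \<Rightarrow> int set \<Rightarrow> (int \<Rightarrow> 'a) \<Rightarrow> bool" where
  "orbit_sequence X f I x \<longleftrightarrow>
     (\<forall>k\<in>I. x k \<in> topspace X \<and> f (x k) = x (k + 1)) \<and>
     (I = UNIV \<or> (\<exists>n. I = {n..} \<and> set_iterate X f (- 1) {x n} = {}))"

definition dense_orbit_sequence ::
    "'a topology \<Rightarrow> ('a \<Rightarrow> 'a) \<Rightarrow> int set \<Rightarrow> (int \<Rightarrow> 'a) \<Rightarrow> bool" where
  "dense_orbit_sequence X f I x \<longleftrightarrow>
     orbit_sequence X f I x \<and> X closure_of (x ` I) = topspace X"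

definition omega_limit :: "'a topology \<Rightarrow> ('a \<Rightarrow> 'a) \<Rightarrow> 'a \<Rightarrow> 'a set" where
  "omega_limit X f x = (\<Inter>n. X closure_of {(f ^^ k) x | k. k \<ge> n})"

definition hitting_times ::
    "'a topology \<Rightarrow> ('a \<Rightarrow> 'a) \<Rightarrow> 'a set \<Rightarrow> 'a set \<Rightarrow> int set" where
  "hitting_times X f A B = {k. A \<inter> set_iterate X f (- k) B \<noteq> {}}"

definition nonneg_hitting_times ::
    "'a topology \<Rightarrow> ('a \<Rightarrow> 'a) \<Rightarrow> 'a set \<Rightarrow> 'a set \<Rightarrow> int set" where
  "nonneg_hitting_times X f A B = hitting_times X f A B \<inter> \<nat>"

definition topologically_transitive :: "'a topology \<Rightarrow> ('a \<Rightarrow> 'a) \<Rightarrow> bool" where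
  "topologically_transitive X f \<longleftrightarrow>
     (\<forall>U V. openin X U \<and> U \<noteq> {} \<and> openin X V \<and> V \<noteq> {} \<longrightarrow>
            hitting_times X f U V \<noteq> {})"

end

theory Submission
  imports Defs
begin

text \<open>Both parts compare the times at which one dense orbit visits \<open>U\<close> and
  \<open>V\<close>. For (a), density gives \<open>x i\<close> in \<open>U\<close> and
  \<open>x j\<close> in \<open>V\<close>; by \<open>hitting_times_orbit_sequence\<close> the
  difference \<open>j - i\<close> is a hitting time whatever its sign, since the earlier of the two
  points is carried to the later one by an iterate of \<open>f\<close>. For (b), a full omega-limit
  set makes every tail of the orbit dense (\<open>omega_limit_full_visits\<close>), so after one
  visit to \<open>U\<close> at time \<open>k\<close> there are visits to \<open>V\<close> at
  arbitrarily late times \<open>l\<close>, and the differences \<open>l - k\<close> are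
  unbounded.\<close>

lemma openin_meets_dense:
  assumes "X closure_of S = topspace X" "openin X U" "U \<noteq> {}"
  shows "\<exists>y\<in>S. y \<in> U"
  using assms unfolding dense_intersects_open by blast

lemma orbit_sequence_funpow:
  assumes "orbit_sequence X f I x" "i \<in> I"
  shows "(f ^^ n) (x i) = x (i + int n)"
proof (induction n)
  case (Suc n)
  \<comment> \<open>The index set is all of the integers or an upward ray, so moving forward never
    leaves it.\<close>
  have "i + int n \<in> I"
    using assms by (auto simp: orbit_sequence_def)
  then show ?case
    using Suc assms(1) by (simp add: orbit_sequence_def algebra_simps)
qed simp

lemma hitting_times_orbit_sequence:
  assumes "orbit_sequence X f I x" "i \<in> I" "j \<in> I" "x i \<in> U" "x j \<in> V"
  shows "j - i \<in> hitting_times X f U V"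
proof -
  have "x i \<in> set_iterate X f (- (j - i)) V"
  \<comment> \<open>The sign decides which branch of \<open>set_iterate\<close> applies: the image
    for \<open>j \<le> i\<close> (equality included), the preimage otherwise.\<close>
  proof (cases "j \<le> i")
    case True
    then have "x i = (f ^^ nat (i - j)) (x j)"
      using orbit_sequence_funpow[OF assms(1,3)] by simp
    then show ?thesis
      using True assms(5) by (simp add: set_iterate_def)
  next
    case False
    then have "(f ^^ nat (j - i)) (x i) = x j"
      using orbit_sequence_funpow[OF assms(1,2)] by simp
    then show ?thesis
      using False assms by (simp add: set_iterate_def orbit_sequence_def)
  qed
  then show ?thesis
    using assms(4) by (auto simp: hitting_times_def)
qed

lemma dense_orbit_sequence_imp_transitive:
  assumes "dense_orbit_sequence X f I x"
  shows "topologically_transitive X f"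
  unfolding topologically_transitive_def
proof (intro allI impI)
  fix U V
  assume UV: "openin X U \<and> U \<noteq> {} \<and> openin X V \<and> V \<noteq> {}"
  have orb: "orbit_sequence X f I x" and dense: "X closure_of (x ` I) = topspace X"
    using assms by (auto simp: dense_orbit_sequence_def)
  obtain i where "i \<in> I" "x i \<in> U"
    using openin_meets_dense[OF dense, of U] UV by auto
  moreover obtain j where "j \<in> I" "x j \<in> V"
    using openin_meets_dense[OF dense, of V] UV by auto
  ultimately show "hitting_times X f U V \<noteq> {}"
    using hitting_times_orbit_sequence[OF orb] by blast
qed

text \<open>An intersection of closures of tails can be the whole space only if each tail is
  dense.\<close>

lemma omega_limit_full_visits:
  assumes "omega_limit X f x = topspace X" "openin X U" "U \<noteq> {}"
  shows "\<exists>k\<ge>n. (f ^^ k) x \<in> U"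
proof -
  have "topspace X \<subseteq> X closure_of {(f ^^ k) x | k. k \<ge> n}"
    using assms(1) unfolding omega_limit_def by blast
  then have "X closure_of {(f ^^ k) x | k. k \<ge> n} = topspace X"
    by (simp add: closure_of_subset_topspace subset_antisym)
  from openin_meets_dense[OF this assms(2,3)] show ?thesis
    by blast
qed

lemma funpow_in_nonneg_hitting_times:
  assumes "openin X U" "y \<in> U" "(f ^^ n) y \<in> V"
  shows "int n \<in> nonneg_hitting_times X f U V"
proof -
  have "y \<in> topspace X"
    using assms(1,2) openin_subset by blast
  then have "y \<in> set_iterate X f (- int n) V"
    \<comment> \<open>For \<open>n = 0\<close> the definition takes the image under the identity;
      for \<open>n > 0\<close> it takes a preimage inside the space.\<close>
    using assms(3) by (cases "n = 0") (auto simp: set_iterate_def)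
  then show ?thesis
    using assms(2) by (auto simp: nonneg_hitting_times_def hitting_times_def)
qed

lemma omega_limit_full_infinite_hitting_times:
  assumes "omega_limit X f x = topspace X"
    and U: "openin X U" "U \<noteq> {}" and V: "openin X V" "V \<noteq> {}"
  shows "infinite (nonneg_hitting_times X f U V)"
proof -
  obtain k where k: "(f ^^ k) x \<in> U"
    using omega_limit_full_visits[OF assms(1) U] by blast
  have "\<exists>n\<ge>m. n \<in> {n. int n \<in> nonneg_hitting_times X f U V}" for m
  proof -
    \<comment> \<open>Waiting until \<open>m + k\<close> makes the natural subtraction
      \<open>l - k\<close> exact and at least \<open>m\<close>.\<close>
    obtain l where l: "l \<ge> m + k" "(f ^^ l) x \<in> V"
      using omega_limit_full_visits[OF assms(1) V] by blast
    then have "(f ^^ (l - k)) ((f ^^ k) x) \<in> V"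
      using fun_cong[OF funpow_add[of "l - k" k f], of x] by simp
    then have "int (l - k) \<in> nonneg_hitting_times X f U V"
      by (rule funpow_in_nonneg_hitting_times[OF U(1) k])
    moreover have "l - k \<ge> m"
      using l(1) by simp
    ultimately show ?thesis
      by blast
  qed
  then have "infinite {n. int n \<in> nonneg_hitting_times X f U V}"
    unfolding infinite_nat_iff_unbounded_le by blast
  moreover have "{n. int n \<in> nonneg_hitting_times X f U V} = int -` nonneg_hitting_times X f U V"
    by auto
  \<comment> \<open>As \<open>int\<close> is injective, a finite set of integers would have a finite
    preimage.\<close>
  ultimately show ?thesis
    by (metis finite_vimageI inj_of_nat)
qed

theorem proposition1p2:
  fixes X :: "'a topology" and f :: "'a \<Rightarrow> 'a"
  assumes "dynamical_system X f"
  shows "((\<exists>I x. dense_orbit_sequence X f I x) \<longrightarrow> topologically_transitive X f) \<and>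
         ((\<exists>x\<in>topspace X. omega_limit X f x = topspace X) \<longrightarrow>
            (\<forall>U V. openin X U \<and> U \<noteq> {} \<and> openin X V \<and> V \<noteq> {} \<longrightarrow>
                   infinite (nonneg_hitting_times X f U V)))"
  by (intro conjI impI allI; elim exE bexE conjE)
    (simp_all add: dense_orbit_sequence_imp_transitive omega_limit_full_infinite_hitting_times)

end
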